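(* Let $F$ be a gauge on $\mathbb{R}^2$ that is smooth on $\mathbb{R}^2\setminus\{0\}$ and whose unit circle $S=\{x:F(x)=1\}$ is smooth and strictly convex. Let $\gamma(\tau)=(\gamma_1(\tau),\gamma_2(\tau))$ be an oriented smooth regular curve in $(\mathbb{R}^2,F)$ with arbitrary parameter $\tau$, let $'$ denote $d/d\tau$, and let $k_n$ be the normal curvature of $\gamma$. With $F_{x_i}=\partial F/\partial x_i$: (i) If $\gamma_1'\neq 0$, then $$k_n=\frac{(F_{x_2}(\gamma_1',\gamma_2'))'}{\gamma_1'}.$$ (ii) If $\gamma_2'\neq 0$, then $$k_n=-\frac{(F_{x_1}(\gamma_1',\gamma_2'))'}{\gamma_2'}.$$
   Context: A gauge on $\mathbb{R}^2$ is a function $F:\mathbb{R}^2\to\mathbb{R}$ with $F(x)\ge 0$, $F(x)=0\Leftrightarrow x=0$; $F(\lambda x)=\lambda F(x)$ for $\lambda>0$; $F(x+y)\le F(x)+F(y)$ (no symmetry assumed). For $x=(x_1,x_2)$, $y=(y_1,y_2)$ put $[x,y]=x_1y_2-x_2y_1$. The associated gauge is $F_a(x)=\sup\{[y,x]:F(y)=1\}$, with unit circle $S_a=\{x:F_a(x)=1\}$; the gauge $F_{a,a}=(F_a)_a$ associated to $F_a$ satisfies $F_{a,a}(x)=F(-x)$. Normal curvature: let $s$ be the arc-length parameter of $\gamma$, $ds/d\tau=F(\gamma'(\tau))$, so $F(d\gamma/ds)=1$. Let $\varphi(u)$ be a counter-clockwise parametrization of $S$ with $[\varphi(u),\varphi'(u)]=1$,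 write $\frac{d\gamma}{ds}(s)=\varphi(u(s))$ with $u(s)$ continuous, and let $n_\gamma(s)=\varphi'(u(s))\in S_a$ be the right normal vector field. Let $\psi(v)$ be a counter-clockwise parametrization of $S_a$ with $F_{a,a}(\psi'(v))=F(-\psi'(v))=1$, and write $n_\gamma(s)=\psi(v(s))$ with $v(s)$ continuous. Then $k_n:=dv/ds$, evaluated at the corresponding point of the curve. *)

theory Defs
  imports "HOL-Analysis.Analysis"
begin

section \<open>Smooth maps\<close>

text \<open>\<open>n\<close>-fold continuous differentiability and smoothness on an open set.\<close>

fun cont_diff_on :: "nat \<Rightarrow> 'a::real_normed_vector set \<Rightarrow> ('a \<Rightarrow> 'b::real_normed_vector) \<Rightarrow> bool"
  where
    "cont_diff_on 0 S f \<longleftrightarrow> continuous_on S f"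
  | "cont_diff_on (Suc n) S f \<longleftrightarrow>
       (\<forall>x\<in>S. f differentiable (at x)) \<and>
       (\<forall>w. cont_diff_on n S (\<lambda>x. frechet_derivative f (at x) w))"

definition smooth_on :: "'a::real_normed_vector set \<Rightarrow> ('a \<Rightarrow> 'b::real_normed_vector) \<Rightarrow> bool"
  where "smooth_on S f \<longleftrightarrow> (\<forall>n. cont_diff_on n S f)"

definition partial_deriv :: "2 \<Rightarrow> (real^2 \<Rightarrow> real) \<Rightarrow> real^2 \<Rightarrow> real"
  where "partial_deriv i F x = deriv (\<lambda>h. F (x + h *\<^sub>R axis i 1)) 0"

section \<open>Gauges on the plane\<close>

text \<open>The name \<open>gauge\<close> is already taken by Henstock-Kurzweil integration.\<close>

definition plane_gauge :: "(real^2 \<Rightarrow> real) \<Rightarrow> bool"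
  where "plane_gauge F \<longleftrightarrow>
    (\<forall>x. F x \<ge> 0) \<and> (\<forall>x. F x = 0 \<longleftrightarrow> x = 0) \<and>
    (\<forall>x. \<forall>l>0. F (l *\<^sub>R x) = l * F x) \<and>
    (\<forall>x y. F (x + y) \<le> F x + F y)"

definition bracket :: "real^2 \<Rightarrow> real^2 \<Rightarrow> real"
  where "bracket x y = x $ 1 * y $ 2 - x $ 2 * y $ 1"

definition unit_circle :: "(real^2 \<Rightarrow> real) \<Rightarrow> (real^2) set"
  where "unit_circle F = {x. F x = 1}"

definition assoc_gauge :: "(real^2 \<Rightarrow> real) \<Rightarrow> real^2 \<Rightarrow> real"
  where "assoc_gauge F x = (SUP y\<in>unit_circle F. bracket y x)"

definition smooth_closed_curve :: "(real^2) set \<Rightarrow> bool"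
  where "smooth_closed_curve C \<longleftrightarrow>
    (\<exists>(c :: real \<Rightarrow> real^2) p. p > 0 \<and> smooth_on UNIV c \<and>
       (\<forall>t. vector_derivative c (at t) \<noteq> 0) \<and> (\<forall>t. c (t + p) = c t) \<and>
       inj_on c {0..<p} \<and> range c = C)"

text \<open>Strict convexity of a convex closed curve: it contains no nondegenerate segment.
  Points of vanishing curvature are allowed.\<close>

definition strictly_convex_curve :: "(real^2) set \<Rightarrow> bool"
  where "strictly_convex_curve C \<longleftrightarrow>
    (\<forall>x\<in>C. \<forall>y\<in>C. x \<noteq> y \<longrightarrow> \<not> closed_segment x y \<subseteq> C)"

text \<open>A regular parametrization of a closed curve that bounds a convex region with the origin in
  its interior. For such a curve, being traversed counter-clockwise means that the polar angle
  increases, that is, \<open>[c, c'] > 0\<close>.\<close>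

definition ccw_param :: "(real \<Rightarrow> real^2) \<Rightarrow> (real^2) set \<Rightarrow> bool"
  where "ccw_param c C \<longleftrightarrow>
    range c = C \<and>
    (\<forall>t. c differentiable (at t) \<and> bracket (c t) (vector_derivative c (at t)) > 0)"

section \<open>Normal curvature\<close>

text \<open>The data in the definition of the normal curvature of a curve \<open>\<gamma>\<close> defined on an open
  interval \<open>I\<close>: the arc length \<open>s\<close> as a function of the parameter, the parametrizations \<open>\<phi>\<close> of
  \<open>S\<close> and \<open>\<psi>\<close> of \<open>S\<^sub>a\<close>, and the functions \<open>u\<close> and \<open>v\<close> of the arc length. The function
  \<open>\<gamma> \<circ> the_inv_into I s\<close> is \<open>\<gamma>\<close> reparametrized by arc length, and \<open>vector_derivative \<phi> (at (u \<sigma>))\<close>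
  is the right normal at arc length \<open>\<sigma>\<close>. Differentiability of \<open>u\<close> and \<open>v\<close> is not required.\<close>

definition normal_curvature_data ::
    "(real^2 \<Rightarrow> real) \<Rightarrow> real set \<Rightarrow> (real \<Rightarrow> real^2) \<Rightarrow> (real \<Rightarrow> real) \<Rightarrow>
     (real \<Rightarrow> real^2) \<Rightarrow> (real \<Rightarrow> real) \<Rightarrow> (real \<Rightarrow> real^2) \<Rightarrow> (real \<Rightarrow> real) \<Rightarrow> bool"
  where "normal_curvature_data F I \<gamma> s \<phi> u \<psi> v \<longleftrightarrow>
    (\<forall>\<tau>\<in>I. (s has_real_derivative F (vector_derivative \<gamma> (at \<tau>))) (at \<tau>)) \<and>
    ccw_param \<phi> (unit_circle F) \<and>
    (\<forall>t. bracket (\<phi> t) (vector_derivative \<phi> (at t)) = 1) \<and>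
    continuous_on (s ` I) u \<and>
    (\<forall>\<sigma>\<in>s ` I. ((\<gamma> \<circ> the_inv_into I s) has_vector_derivative \<phi> (u \<sigma>)) (at \<sigma>)) \<and>
    ccw_param \<psi> (unit_circle (assoc_gauge F)) \<and>
    (\<forall>t. assoc_gauge (assoc_gauge F) (vector_derivative \<psi> (at t)) = 1) \<and>
    continuous_on (s ` I) v \<and>
    (\<forall>\<sigma>\<in>s ` I. vector_derivative \<phi> (at (u \<sigma>)) = \<psi> (v \<sigma>))"

text \<open>\<open>dv/ds\<close> at the point with parameter \<open>\<tau>\<close>.\<close>

definition normal_curvature :: "(real \<Rightarrow> real) \<Rightarrow> (real \<Rightarrow> real) \<Rightarrow> real \<Rightarrow> real"
  where "normal_curvature s v \<tau> = deriv v (s \<tau>)"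

end

theory Submission
  imports Defs
begin

text \<open>Write \<open>T\<close> for the unit tangent and \<open>n\<close> for the right normal. Euler's identity and \<open>[T, n] = 1\<close>
  give \<open>n = (- F\<^sub>2, F\<^sub>1)(T)\<close>, and \<open>T\<close> may be replaced by \<open>\<gamma>'\<close> since the partial derivatives of \<open>F\<close>
  are homogeneous of degree 0. By duality \<open>\<psi>'(v) = - T\<close>, so differentiating \<open>\<psi>(v) = n\<close> gives
  \<open>dn/ds = - k\<^sub>n T\<close>; its two components, with \<open>\<gamma>' = F(\<gamma>') T\<close> and \<open>ds/d\<tau> = F(\<gamma>')\<close>, are the two
  formulas. Differentiability of \<open>v\<close> follows from that of \<open>n\<close> because \<open>\<psi>'\<close> does not vanish.\<close>

section \<open>The bracket form and derivatives of composed functions\<close>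

lemma bracket_swap: "bracket x y = - bracket y x"
  by (simp add: bracket_def)

text \<open>A crude constant is enough: the estimate only serves to show that the set of brackets in
  the definition of \<open>assoc_gauge\<close> is bounded above.\<close>

lemma abs_bracket_le: "\<bar>bracket x y\<bar> \<le> 2 * norm x * norm y"
proof -
  have "\<bar>bracket x y\<bar> \<le> \<bar>x $ 1\<bar> * \<bar>y $ 2\<bar> + \<bar>x $ 2\<bar> * \<bar>y $ 1\<bar>"
    unfolding bracket_def by (metis abs_mult abs_triangle_ineq4)
  also have "\<dots> \<le> norm x * norm y + norm x * norm y"
    by (intro add_mono mult_mono component_le_norm_cart) auto
  finally show ?thesis by simp
qed

lemma has_vector_derivative_bracket_right:
  assumes "(f has_vector_derivative f') (at t)"
  shows "((\<lambda>t. bracket a (f t)) has_real_derivative bracket a f') (at t)"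
proof -
  have "((\<lambda>t. f t $ i) has_real_derivative f' $ i) (at t)" for i
    using bounded_linear.has_vector_derivative[OF bounded_linear_vec_nth assms]
    by (simp add: has_real_derivative_iff_has_vector_derivative)
  then show ?thesis
    unfolding bracket_def by (auto intro!: derivative_eq_intros)
qed

text \<open>Cramer's rule in the plane: \<open>bracket a b *\<^sub>R y = bracket y b *\<^sub>R a +
  bracket a y *\<^sub>R b\<close>.\<close>

lemma bracket_eq_0_imp_parallel:
  assumes "bracket a b = 1" "bracket a y = 0"
  shows "y = bracket y b *\<^sub>R a"
proof -
  have "y $ 1 = y $ 1 * bracket a b - bracket a y * b $ 1" "y $ 2 = y $ 2 * bracket a b - bracket a y * b $ 2"
    using assms by simp_all
  then have "y $ 1 = bracket y b * a $ 1" "y $ 2 = bracket y b * a $ 2"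
    by (simp_all add: bracket_def algebra_simps)
  then show ?thesis
    by (simp add: vec_eq_iff forall_2)
qed

text \<open>The difference quotients of \<open>g \<circ> w\<close> factor through those of \<open>g\<close>, which stay away
  from 0; this needs \<open>g\<close> to be differentiable at one point only, not injective nearby.\<close>

lemma has_real_derivative_cancel_left:
  fixes g w :: "real \<Rightarrow> real"
  assumes g: "(g has_real_derivative D) (at (w a))" and "D \<noteq> 0"
    and gw: "((\<lambda>t. g (w t)) has_real_derivative E) (at a)"
    and w: "isCont w a"
  shows "(w has_real_derivative E / D) (at a)"
proof -
  \<comment> \<open>Caratheodory's form of the derivative avoids dividing by
    \<open>w t - w a\<close>, which may vanish for \<open>t\<close> arbitrarily close to
    \<open>a\<close>.\<close>
  obtain q where q: "\<And>z. g z - g (w a) = q z * (z - w a)" "isCont q (w a)" "q (w a) = D"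
    using g by (auto simp: CARAT_DERIV)
  obtain r where r: "\<And>z. g (w z) - g (w a) = r z * (z - a)" "isCont r a" "r a = E"
    using gw by (auto simp: CARAT_DERIV)
  have qw: "isCont (\<lambda>t. q (w t)) a"
    using isCont_o2[OF w q(2)] .
  have "(\<lambda>t. q (w t)) \<midarrow>a\<rightarrow> D"
    using qw q(3) by (simp add: isCont_def)
  then have "\<forall>\<^sub>F t in at a. q (w t) \<noteq> 0"
    using \<open>D \<noteq> 0\<close> by (rule tendsto_imp_eventually_ne)
  then have ev: "\<forall>\<^sub>F t in at a. r t / q (w t) = (w t - w a) / (t - a)"
    using eventually_at_ball'[OF zero_less_one, of a UNIV]
  proof eventually_elim
    case (elim t)
    have "q (w t) * (w t - w a) = r t * (t - a)"
      using q(1)[of "w t"] r(1)[of t] by simp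
    then show ?case
      using elim by (simp add: field_simps)
  qed
  have "((\<lambda>t. r t / q (w t)) \<longlongrightarrow> E / D) (at a)"
    using qw r(2) q(3) r(3) \<open>D \<noteq> 0\<close> by (auto simp: isCont_def intro!: tendsto_eq_intros)
  then have "((\<lambda>t. (w t - w a) / (t - a)) \<longlongrightarrow> E / D) (at a)"
    unfolding tendsto_cong[OF ev] .
  then show ?thesis
    by (simp add: has_field_derivative_iff)
qed

section \<open>Smoothness and partial derivatives\<close>

lemma smooth_onD:
  assumes "smooth_on S f" "x \<in> S"
  shows "f differentiable (at x)" "(\<lambda>x. frechet_derivative f (at x) w) differentiable (at x)"
proof -
  have "cont_diff_on (Suc (Suc 0)) S f"
    using assms(1) by (simp only: smooth_on_def)
  then show "f differentiable (at x)" "(\<lambda>x. frechet_derivative f (at x) w) differentiable (at x)"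
    using assms(2) by auto
qed

lemma has_vector_derivative_compose_frechet:
  assumes "(f has_vector_derivative f') (at t)" "F differentiable (at (f t))"
  shows "((\<lambda>z. F (f z)) has_vector_derivative frechet_derivative F (at (f t)) f') (at t)"
proof -
  have "(F has_derivative frechet_derivative F (at (f t))) (at (f t) within range f)"
    using assms(2) by (simp add: frechet_derivative_works has_derivative_at_withinI)
  then show ?thesis
    using vector_derivative_diff_chain_within[OF assms(1)] by (simp add: o_def)
qed

lemma partial_deriv_eq_frechet_derivative:
  assumes "F differentiable (at x)"
  shows "partial_deriv i F x = frechet_derivative F (at x) (axis i 1)"
proof -
  have "((\<lambda>h. x + h *\<^sub>R axis i 1) has_vector_derivative axis i 1) (at 0)"
    by (auto intro!: derivative_eq_intros simp: has_vector_derivative_def)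
  then have "((\<lambda>h. F (x + h *\<^sub>R axis i 1)) has_vector_derivative
      frechet_derivative F (at x) (axis i 1)) (at 0)"
    using has_vector_derivative_compose_frechet[of "\<lambda>h. x + h *\<^sub>R axis i 1" _ 0 F] assms by simp
  then show ?thesis
    unfolding partial_deriv_def
    by (intro DERIV_imp_deriv) (simp add: has_real_derivative_iff_has_vector_derivative)
qed

lemma frechet_derivative_eq_partial_deriv:
  assumes "F differentiable (at x)"
  shows "frechet_derivative F (at x) w = w $ 1 * partial_deriv 1 F x + w $ 2 * partial_deriv 2 F x"
proof -
  interpret linear "frechet_derivative F (at x)"
    using assms by (rule linear_frechet_derivative)
  have "w = w $ 1 *\<^sub>R axis 1 1 + w $ 2 *\<^sub>R axis 2 1"
    by (simp add: vec_eq_iff forall_2 axis_def)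
  then have "frechet_derivative F (at x) w = frechet_derivative F (at x) (w $ 1 *\<^sub>R axis 1 1 + w $ 2 *\<^sub>R axis 2 1)"
    by metis
  then show ?thesis
    using assms by (simp add: add scale partial_deriv_eq_frechet_derivative)
qed

section \<open>Consequences of homogeneity\<close>

text \<open>Differentiating \<open>F (l *\<^sub>R z) = l * F z\<close> in \<open>z\<close> produces
  a factor \<open>l\<close> on both sides, which cancels.\<close>

lemma plane_gauge_partial_deriv_scale:
  assumes F: "plane_gauge F" and "l > 0"
    and d: "F differentiable (at x)" "F differentiable (at (l *\<^sub>R x))"
  shows "partial_deriv i F (l *\<^sub>R x) = partial_deriv i F x"
proof -
  define A where "A = frechet_derivative F (at (l *\<^sub>R x))"
  define B where "B = frechet_derivative F (at x)"
  have "(F has_derivative A) (at (l *\<^sub>R x))"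
    using d(2) by (simp add: A_def frechet_derivative_works)
  then have "((\<lambda>z. F (l *\<^sub>R z)) has_derivative (\<lambda>w. A (l *\<^sub>R w))) (at x)"
    by (intro has_derivative_compose[of "\<lambda>z. l *\<^sub>R z" "\<lambda>w. l *\<^sub>R w" x UNIV F])
      (auto intro!: derivative_eq_intros)
  moreover have "((\<lambda>z. l * F z) has_derivative (\<lambda>w. l * B w)) (at x)"
    using d(1) by (auto simp: B_def frechet_derivative_works intro!: derivative_eq_intros)
  moreover have "F (l *\<^sub>R z) = l * F z" for z
    using F \<open>l > 0\<close> by (auto simp: plane_gauge_def)
  ultimately have "(\<lambda>w. A (l *\<^sub>R w)) = (\<lambda>w. l * B w)"
    by (simp add: has_derivative_unique)
  moreover have "A (l *\<^sub>R w) = l * A w" for w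
    using linear_frechet_derivative[OF d(2)] by (simp add: A_def linear_cmul)
  ultimately have "A = B"
    using \<open>l > 0\<close> by (auto simp: fun_eq_iff)
  then show ?thesis
    using d by (simp add: A_def B_def partial_deriv_eq_frechet_derivative)
qed

text \<open>Differentiate \<open>F (h *\<^sub>R x)\<close> in \<open>h\<close> at 1, once by the
  chain rule and once by homogeneity.\<close>

lemma plane_gauge_euler:
  assumes F: "plane_gauge F" and d: "F differentiable (at x)"
  shows "x $ 1 * partial_deriv 1 F x + x $ 2 * partial_deriv 2 F x = F x"
proof -
  have "((\<lambda>h. h *\<^sub>R x) has_vector_derivative x) (at 1)"
    by (auto intro!: derivative_eq_intros simp: has_vector_derivative_def)
  then have "((\<lambda>h. F (h *\<^sub>R x)) has_vector_derivative frechet_derivative F (at x) x) (at 1)"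
    using has_vector_derivative_compose_frechet[of "\<lambda>h. h *\<^sub>R x" x 1 F] d by simp
  then have 1: "((\<lambda>h. F (h *\<^sub>R x)) has_real_derivative frechet_derivative F (at x) x) (at 1)"
    by (simp add: has_real_derivative_iff_has_vector_derivative)
  have 2: "((\<lambda>h. h * F x) has_real_derivative F x) (at 1)"
    by (auto intro!: derivative_eq_intros)
  \<comment> \<open>Homogeneity holds for positive factors only, so the two functions of
    \<open>h\<close> are compared on the open half-line, a neighbourhood of 1.\<close>
  have "((\<lambda>h. F (h *\<^sub>R x)) has_real_derivative F x) (at 1)"
    by (rule has_field_derivative_transform_within_open[OF 2, of "{0<..}"])
      (use F in \<open>auto simp: plane_gauge_def\<close>)
  then have "frechet_derivative F (at x) x = F x"
    using 1 DERIV_unique by blast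
  then show ?thesis
    using frechet_derivative_eq_partial_deriv[OF d] by simp
qed

section \<open>Unit circles of the gauge and of its associated gauge\<close>

text \<open>By compactness \<open>F\<close> attains a positive minimum on the Euclidean unit sphere;
  homogeneity extends the bound to the plane. Hence the unit circle of \<open>F\<close> is
  bounded.\<close>

lemma plane_gauge_lower_bound:
  assumes F: "plane_gauge F" and c: "continuous_on (UNIV - {0}) F"
  obtains m where "m > 0" "\<And>x. m * norm x \<le> F x"
proof -
  have "continuous_on (sphere 0 1) F"
    by (rule continuous_on_subset[OF c]) auto
  then obtain y where y: "y \<in> sphere 0 1" "\<And>x. x \<in> sphere 0 1 \<Longrightarrow> F y \<le> F x"
    using continuous_attains_inf[of "sphere (0::real^2) 1" F] by auto
  have "y \<noteq> 0" using y(1) by auto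
  then have "F y > 0"
    using F unfolding plane_gauge_def by (metis less_eq_real_def)
  moreover have "F y * norm x \<le> F x" for x
  proof (cases "x = 0")
    case False
    have "F (norm x *\<^sub>R (x /\<^sub>R norm x)) = norm x * F (x /\<^sub>R norm x)"
      using F False unfolding plane_gauge_def by (metis zero_less_norm_iff)
    moreover have "F y \<le> F (x /\<^sub>R norm x)"
      using False by (intro y(2)) auto
    ultimately show ?thesis
      using False by (simp add: mult.commute mult_left_mono)
  qed (use F in \<open>auto simp: plane_gauge_def\<close>)
  ultimately show ?thesis using that by blast
qed

text \<open>A real supremum dominates its set only if that set is bounded above, which the
  boundedness of the unit circle ensures.\<close>

lemma bracket_le_assoc_gauge:
  assumes F: "plane_gauge F" and c: "continuous_on (UNIV - {0}) F" and "F y = 1"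
  shows "bracket y x \<le> assoc_gauge F x"
  unfolding assoc_gauge_def
proof (rule cSUP_upper)
  obtain m where m: "m > 0" "\<And>x. m * norm x \<le> F x"
    using plane_gauge_lower_bound[OF F c] by blast
  have "bracket z x \<le> 2 * (1 / m) * norm x" if "F z = 1" for z
  proof -
    have "norm z \<le> 1 / m"
      using m(1) m(2)[of z] that by (simp add: field_simps)
    then have "2 * norm z * norm x \<le> 2 * (1 / m) * norm x"
      by (intro mult_right_mono) auto
    then show ?thesis
      using abs_bracket_le[of z x] by linarith
  qed
  then show "bdd_above ((\<lambda>y. bracket y x) ` unit_circle F)"
    by (auto simp: unit_circle_def bdd_above_def)
qed (use assms in \<open>auto simp: unit_circle_def\<close>)

text \<open>This is the duality \<open>assoc_gauge (assoc_gauge F) x = F (- x)\<close> on the ray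
  through \<open>- y\<close>. The given dual point \<open>n\<close> attains the supremum, so no
  separation argument is used.\<close>

lemma assoc_assoc_gauge_normed:
  assumes F: "plane_gauge F" and c: "continuous_on (UNIV - {0}) F"
    and "F y = 1" "assoc_gauge F n = 1" "bracket y n = 1" "l \<ge> 0"
  shows "assoc_gauge (assoc_gauge F) (- l *\<^sub>R y) = l"
  unfolding assoc_gauge_def[of "assoc_gauge F"]
proof (rule cSup_eq_maximum)
  have *: "bracket z (- (l *\<^sub>R y)) = l * bracket y z" for z
    by (simp add: bracket_def algebra_simps)
  show "l \<in> (\<lambda>z. bracket z (- l *\<^sub>R y)) ` unit_circle (assoc_gauge F)"
    using assms(4,5) by (intro image_eqI[of _ _ n]) (auto simp: * unit_circle_def)
  fix b assume "b \<in> (\<lambda>z. bracket z (- l *\<^sub>R y)) ` unit_circle (assoc_gauge F)"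
  then obtain z where "b = l * bracket y z" "assoc_gauge F z = 1"
    by (auto simp: * unit_circle_def)
  then show "b \<le> l"
    using bracket_le_assoc_gauge[OF F c \<open>F y = 1\<close>, of z] \<open>l \<ge> 0\<close>
    by (simp add: mult_left_le)
qed

text \<open>The linear functional \<open>bracket y\<close> is at most 1 on the curve \<open>\<psi>\<close> and equals 1 at
  \<open>\<psi> t\<close>, so \<open>\<psi>' t\<close> is parallel to \<open>y\<close>; orientation and normalization fix the factor.\<close>

lemma vector_derivative_dual_circle:
  assumes F: "plane_gauge F" and c: "continuous_on (UNIV - {0}) F" and "F y = 1"
    and \<psi>: "ccw_param \<psi> (unit_circle (assoc_gauge F))"
    and norm: "assoc_gauge (assoc_gauge F) (vector_derivative \<psi> (at t)) = 1"
    and 1: "bracket y (\<psi> t) = 1"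
  shows "vector_derivative \<psi> (at t) = - y"
proof -
  define d where "d = vector_derivative \<psi> (at t)"
  have circ: "assoc_gauge F (\<psi> z) = 1" for z
    using \<psi> by (auto simp: ccw_param_def unit_circle_def)
  have "(\<psi> has_vector_derivative d) (at t)"
    using \<psi> by (auto simp: ccw_param_def d_def vector_derivative_works[symmetric])
  then have der: "((\<lambda>z. bracket y (\<psi> z)) has_real_derivative bracket y d) (at t)"
    by (rule has_vector_derivative_bracket_right)
  have "bracket y (\<psi> z) \<le> bracket y (\<psi> t)" for z
    using bracket_le_assoc_gauge[OF F c \<open>F y = 1\<close>, of "\<psi> z"] circ 1 by simp
  then have "bracket y d = 0"
    using DERIV_local_max[OF der zero_less_one] by blast
  then have d: "d = bracket d (\<psi> t) *\<^sub>R y"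
    by (rule bracket_eq_0_imp_parallel[OF 1])
  have "bracket (\<psi> t) d > 0"
    using \<psi> by (auto simp: ccw_param_def d_def)
  moreover have "d = - bracket (\<psi> t) d *\<^sub>R y"
    using d bracket_swap[of d] by simp
  ultimately have "bracket (\<psi> t) d = 1"
    using assoc_assoc_gauge_normed[OF F c \<open>F y = 1\<close> circ 1, of "bracket (\<psi> t) d"] norm
    by (simp add: d_def)
  then show ?thesis
    using \<open>d = - bracket (\<psi> t) d *\<^sub>R y\<close> by (simp add: d_def)
qed

text \<open>Tangency makes the derivative a multiple of the gradient of \<open>F\<close> rotated by
  a right angle; Euler's identity and the unit bracket force the factor to be 1.\<close>

lemma vector_derivative_unit_circle:
  assumes F: "plane_gauge F" and d: "F differentiable (at (\<phi> t))"
    and \<phi>: "ccw_param \<phi> (unit_circle F)"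
    and 1: "bracket (\<phi> t) (vector_derivative \<phi> (at t)) = 1"
  shows "vector_derivative \<phi> (at t) $ 1 = - partial_deriv 2 F (\<phi> t)"
    and "vector_derivative \<phi> (at t) $ 2 = partial_deriv 1 F (\<phi> t)"
proof -
  define n where "n = vector_derivative \<phi> (at t)"
  have circ: "F (\<phi> z) = 1" for z
    using \<phi> by (auto simp: ccw_param_def unit_circle_def)
  have "(\<phi> has_vector_derivative n) (at t)"
    using \<phi> by (auto simp: ccw_param_def n_def vector_derivative_works[symmetric])
  then have "((\<lambda>z. F (\<phi> z)) has_vector_derivative frechet_derivative F (at (\<phi> t)) n) (at t)"
    using d by (rule has_vector_derivative_compose_frechet)
  then have "frechet_derivative F (at (\<phi> t)) n = 0"
    unfolding circ by (rule vector_derivative_unique_at[OF _ has_vector_derivative_const])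
  then have tangent: "n $ 1 * partial_deriv 1 F (\<phi> t) + n $ 2 * partial_deriv 2 F (\<phi> t) = 0"
    using frechet_derivative_eq_partial_deriv[OF d] by simp
  have euler: "\<phi> t $ 1 * partial_deriv 1 F (\<phi> t) + \<phi> t $ 2 * partial_deriv 2 F (\<phi> t) = 1"
    using plane_gauge_euler[OF F d] circ by simp
  have area: "\<phi> t $ 1 * n $ 2 - \<phi> t $ 2 * n $ 1 = 1"
    using 1 by (simp add: bracket_def n_def)
  show "vector_derivative \<phi> (at t) $ 1 = - partial_deriv 2 F (\<phi> t)"
    unfolding n_def[symmetric] using tangent euler area by algebra
  show "vector_derivative \<phi> (at t) $ 2 = partial_deriv 1 F (\<phi> t)"
    unfolding n_def[symmetric] using tangent euler area by algebra
qed

section \<open>Differentiating the right normal along the curve\<close>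

text \<open>The curvature formulas before division: a single \<open>k\<close> serves both
  components, and either component of the velocity may vanish.\<close>

lemma normal_curvature_data_imp_derivative:
  assumes F: "plane_gauge F" and smooth: "smooth_on (UNIV - {0}) F"
    and "open I" "is_interval I" "smooth_on I \<gamma>"
    and regular: "\<And>t. t \<in> I \<Longrightarrow> vector_derivative \<gamma> (at t) \<noteq> 0"
    and data: "normal_curvature_data F I \<gamma> s \<phi> u \<psi> v"
    and "\<tau> \<in> I"
  obtains k where "(v has_real_derivative k) (at (s \<tau>))"
    "deriv (\<lambda>t. partial_deriv 2 F (vector_derivative \<gamma> (at t))) \<tau> = k * vector_derivative \<gamma> (at \<tau>) $ 1"
    "deriv (\<lambda>t. partial_deriv 1 F (vector_derivative \<gamma> (at t))) \<tau> = - k * vector_derivative \<gamma> (at \<tau>) $ 2"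
proof -
  define \<gamma>' where "\<gamma>' = (\<lambda>t. vector_derivative \<gamma> (at t))"
  define L where "L = F (\<gamma>' \<tau>)"
  define p where "p = (\<lambda>i. deriv (\<lambda>t. partial_deriv i F (\<gamma>' t)) \<tau>)"
  define y where "y = \<phi> (u (s \<tau>))"
  note data' = data[unfolded normal_curvature_data_def]
  have \<phi>: "ccw_param \<phi> (unit_circle F)" "\<And>t. bracket (\<phi> t) (vector_derivative \<phi> (at t)) = 1"
    and \<psi>: "ccw_param \<psi> (unit_circle (assoc_gauge F))"
      "\<And>t. assoc_gauge (assoc_gauge F) (vector_derivative \<psi> (at t)) = 1"
    using data' by auto
  have \<gamma>'_nz: "\<gamma>' t \<noteq> 0" if "t \<in> I" for t
    using regular[OF that] by (simp add: \<gamma>'_def)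
  have F_diff: "F differentiable (at x)" if "x \<noteq> 0" for x
    using smooth_onD(1)[OF smooth] that by simp
  then have F_cont: "continuous_on (UNIV - {0}) F"
    by (intro continuous_at_imp_continuous_on) (auto intro: differentiable_imp_continuous_within)
  have F_pos: "F x > 0" if "x \<noteq> 0" for x
    using F that unfolding plane_gauge_def by (metis less_eq_real_def)
  have L: "L > 0"
    using F_pos \<gamma>'_nz \<open>\<tau> \<in> I\<close> by (simp add: L_def)
  have \<phi>_circ: "F (\<phi> t) = 1" for t
    using \<phi>(1) by (auto simp: ccw_param_def unit_circle_def)
  then have \<phi>_nz: "\<phi> t \<noteq> 0" for t
    using F by (metis plane_gauge_def zero_neq_one)

  have s_der: "(s has_real_derivative F (\<gamma>' t)) (at t)" if "t \<in> I" for t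
    using data' that by (auto simp: \<gamma>'_def)
  then have s_cont: "continuous_on I s"
    by (meson DERIV_isCont continuous_at_imp_continuous_on)
  have s_less: "s a < s b" if "a \<in> I" "b \<in> I" "a < b" for a b
  proof (rule DERIV_pos_imp_increasing[OF \<open>a < b\<close>])
    fix x assume "a \<le> x" "x \<le> b"
    then have "x \<in> I"
      using \<open>is_interval I\<close> that by (meson mem_is_interval_1_I)
    then show "\<exists>y. (s has_real_derivative y) (at x) \<and> y > 0"
      using s_der F_pos \<gamma>'_nz by blast
  qed
  then have s_inj: "inj_on s I"
    by (intro linorder_inj_onI) (force+)
  then have inv_s: "the_inv_into I s (s t) = t" if "t \<in> I" for t
    using that by (rule the_inv_into_f_f)
  \<comment> \<open>Openness turns continuity of \<open>v\<close> on the image of \<open>I\<close>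
    into continuity at \<open>s \<tau>\<close> and allows derivatives there to be transferred
    between functions that agree on this image.\<close>
  have s_open: "open (s ` I)"
    using injective_eq_1d_open_map_UNIV[OF s_cont \<open>is_interval I\<close>] s_inj \<open>open I\<close> by blast
  have inv_der: "(the_inv_into I s has_real_derivative inverse L) (at (s \<tau>))"
    using s_der[OF \<open>\<tau> \<in> I\<close>] L unfolding has_field_derivative_def L_def
    by (intro has_derivative_inverse_strong[OF \<open>open I\<close> \<open>\<tau> \<in> I\<close> s_cont inv_s]) auto

  \<comment> \<open>On \<open>I\<close> the curve is its arc-length form composed with
    \<open>s\<close>, so the chain rule splits the velocity into speed times unit tangent.\<close>
  have \<gamma>'_eq: "\<gamma>' t = F (\<gamma>' t) *\<^sub>R \<phi> (u (s t))" if "t \<in> I" for t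
  proof -
    have "((\<gamma> \<circ> the_inv_into I s) has_vector_derivative \<phi> (u (s t))) (at (s t))"
      using data' that by auto
    then have "((\<gamma> \<circ> the_inv_into I s) \<circ> s has_vector_derivative F (\<gamma>' t) *\<^sub>R \<phi> (u (s t))) (at t)"
      using s_der[OF that]
      by (intro vector_diff_chain_at) (simp add: has_real_derivative_iff_has_vector_derivative)
    then have "(\<gamma> has_vector_derivative F (\<gamma>' t) *\<^sub>R \<phi> (u (s t))) (at t)"
      by (rule has_vector_derivative_transform_within_open[OF _ \<open>open I\<close> that]) (simp add: inv_s)
    then show ?thesis
      unfolding \<gamma>'_def by (rule vector_derivative_at)
  qed
  have \<psi>_eq: "\<psi> (v (s t)) $ 1 = - partial_deriv 2 F (\<gamma>' t)"
      "\<psi> (v (s t)) $ 2 = partial_deriv 1 F (\<gamma>' t)" if "t \<in> I" for t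
  proof -
    have "\<psi> (v (s t)) = vector_derivative \<phi> (at (u (s t)))"
      using data' that by auto
    \<comment> \<open>The velocity is a positive multiple of the unit tangent, and the partial
      derivatives are homogeneous of degree 0.\<close>
    moreover have "partial_deriv i F (\<gamma>' t) = partial_deriv i F (\<phi> (u (s t)))" for i
      using plane_gauge_partial_deriv_scale[OF F, of "F (\<gamma>' t)" "\<phi> (u (s t))" i] \<gamma>'_eq[OF that]
        F_pos F_diff \<gamma>'_nz[OF that] \<phi>_nz by simp
    ultimately show "\<psi> (v (s t)) $ 1 = - partial_deriv 2 F (\<gamma>' t)"
      "\<psi> (v (s t)) $ 2 = partial_deriv 1 F (\<gamma>' t)"
      using vector_derivative_unit_circle[where t = "u (s t)", OF F F_diff[OF \<phi>_nz] \<phi>]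
      by simp_all
  qed

  have p: "((\<lambda>t. partial_deriv i F (\<gamma>' t)) has_real_derivative p i) (at \<tau>)" for i
  proof -
    \<comment> \<open>Smoothness is stated through Frechet derivatives in fixed directions;
      direction 1 recovers the velocity.\<close>
    have "\<gamma>' t = frechet_derivative \<gamma> (at t) 1" if "t \<in> I" for t
      unfolding \<gamma>'_def
      using smooth_onD(1)[OF \<open>smooth_on I \<gamma>\<close> that]
      by (metis frechet_derivative_at has_vector_derivative_def scaleR_one vector_derivative_works)
    moreover have "((\<lambda>x. frechet_derivative F (at x) (axis i 1)) \<circ> (\<lambda>t. frechet_derivative \<gamma> (at t) 1))
        differentiable (at \<tau>)"
      using smooth_onD(2)[OF \<open>smooth_on I \<gamma>\<close> \<open>\<tau> \<in> I\<close>] smooth_onD(2)[OF smooth]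
        \<gamma>'_nz[OF \<open>\<tau> \<in> I\<close>] calculation[OF \<open>\<tau> \<in> I\<close>]
      by (intro differentiable_chain_at) auto
    ultimately have "(\<lambda>t. partial_deriv i F (\<gamma>' t)) differentiable (at \<tau>)"
      unfolding differentiable_def
      by (elim ex_forward has_derivative_transform_within_open[OF _ \<open>open I\<close> \<open>\<tau> \<in> I\<close>])
        (use \<gamma>'_nz F_diff in \<open>force simp: partial_deriv_eq_frechet_derivative\<close>)
    then show ?thesis
      unfolding p_def by (simp add: DERIV_deriv_iff_real_differentiable)
  qed
  have p_inv: "((\<lambda>\<sigma>. partial_deriv i F (\<gamma>' (the_inv_into I s \<sigma>))) has_real_derivative p i * inverse L)
      (at (s \<tau>))" for i
    using p[of i] inv_s[OF \<open>\<tau> \<in> I\<close>] by (intro DERIV_chain2[OF _ inv_der]) simp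
  \<comment> \<open>The normal is differentiated in arc length one component at a time, since the
    cancellation lemma concerns real functions.\<close>
  have \<psi>v1: "((\<lambda>\<sigma>. \<psi> (v \<sigma>) $ 1) has_real_derivative - p 2 * inverse L) (at (s \<tau>))"
    using DERIV_minus[OF p_inv[of 2]]
    by (simp, elim has_field_derivative_transform_within_open[OF _ s_open])
      (use \<open>\<tau> \<in> I\<close> in \<open>auto simp: inv_s \<psi>_eq\<close>)
  have \<psi>v2: "((\<lambda>\<sigma>. \<psi> (v \<sigma>) $ 2) has_real_derivative p 1 * inverse L) (at (s \<tau>))"
    using p_inv[of 1]
    by (elim has_field_derivative_transform_within_open[OF _ s_open])
      (use \<open>\<tau> \<in> I\<close> in \<open>auto simp: inv_s \<psi>_eq\<close>)

  have "bracket y (\<psi> (v (s \<tau>))) = 1"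
    using data' \<open>\<tau> \<in> I\<close> unfolding y_def by (metis imageI)
  then have "vector_derivative \<psi> (at (v (s \<tau>))) = - y"
    using vector_derivative_dual_circle[OF F F_cont _ \<psi>] \<phi>_circ by (simp add: y_def)
  then have "(\<psi> has_vector_derivative - y) (at (v (s \<tau>)))"
    using \<psi>(1) by (metis ccw_param_def vector_derivative_works)
  then have \<psi>_der: "((\<lambda>z. \<psi> z $ i) has_real_derivative - y $ i) (at (v (s \<tau>)))" for i
    using bounded_linear.has_vector_derivative[OF bounded_linear_vec_nth, of \<psi> "- y" _ i]
    by (simp add: has_real_derivative_iff_has_vector_derivative)
  have v_cont: "isCont v (s \<tau>)"
    using data' s_open \<open>\<tau> \<in> I\<close> by (auto simp: continuous_on_eq_continuous_at)
  \<comment> \<open>Some component of the derivative \<open>- y\<close> of \<open>\<psi>\<close> is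
    nonzero, and cancelling that component of \<open>\<psi>\<close> makes \<open>v\<close>
    differentiable.\<close>
  have "y $ 1 \<noteq> 0 \<or> y $ 2 \<noteq> 0"
    using \<phi>_nz by (auto simp: y_def vec_eq_iff forall_2)
  then obtain k where k: "(v has_real_derivative k) (at (s \<tau>))"
    using has_real_derivative_cancel_left[OF \<psi>_der _ \<psi>v1 v_cont]
      has_real_derivative_cancel_left[OF \<psi>_der _ \<psi>v2 v_cont] by (metis neg_equal_0_iff_equal)
  \<comment> \<open>Once \<open>v\<close> is differentiable, the chain rule gives both components,
    including one where \<open>y\<close> vanishes.\<close>
  have "- p 2 * inverse L = - y $ 1 * k" "p 1 * inverse L = - y $ 2 * k"
    using DERIV_unique[OF \<psi>v1 DERIV_chain2[OF \<psi>_der k]]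
      DERIV_unique[OF \<psi>v2 DERIV_chain2[OF \<psi>_der k]] .
  then have "p 2 = k * (L * y $ 1)" "p 1 = - k * (L * y $ 2)"
    using L by (simp_all add: field_simps)
  moreover have "\<gamma>' \<tau> = L *\<^sub>R y"
    using \<gamma>'_eq[OF \<open>\<tau> \<in> I\<close>] by (simp add: L_def y_def)
  ultimately have "p 2 = k * \<gamma>' \<tau> $ 1" "p 1 = - k * \<gamma>' \<tau> $ 2"
    by simp_all
  then show thesis
    using k that by (simp add: p_def \<gamma>'_def)
qed

theorem theorem3p2:
  fixes F :: "real^2 \<Rightarrow> real" and \<gamma> :: "real \<Rightarrow> real^2" and I :: "real set"
    and s u v :: "real \<Rightarrow> real" and \<phi> \<psi> :: "real \<Rightarrow> real^2" and \<tau> :: real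
  defines "\<gamma>' \<equiv> (\<lambda>t. vector_derivative \<gamma> (at t))"
  assumes "plane_gauge F"
    and "smooth_on (UNIV - {0}) F"
    and "smooth_closed_curve (unit_circle F)"
    and "strictly_convex_curve (unit_circle F)"
    and "open I" and "is_interval I"
    and "smooth_on I \<gamma>"
    and "\<And>t. t \<in> I \<Longrightarrow> \<gamma>' t \<noteq> 0"
    and "normal_curvature_data F I \<gamma> s \<phi> u \<psi> v"
    and "\<tau> \<in> I"
  shows "v differentiable (at (s \<tau>)) \<and>
    (\<gamma>' \<tau> $ 1 \<noteq> 0 \<longrightarrow>
       normal_curvature s v \<tau> = deriv (\<lambda>t. partial_deriv 2 F (\<gamma>' t)) \<tau> / \<gamma>' \<tau> $ 1) \<and>
    (\<gamma>' \<tau> $ 2 \<noteq> 0 \<longrightarrow>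
       normal_curvature s v \<tau> = - deriv (\<lambda>t. partial_deriv 1 F (\<gamma>' t)) \<tau> / \<gamma>' \<tau> $ 2)"
proof -
  obtain k where k: "(v has_real_derivative k) (at (s \<tau>))"
    "deriv (\<lambda>t. partial_deriv 2 F (\<gamma>' t)) \<tau> = k * \<gamma>' \<tau> $ 1"
    "deriv (\<lambda>t. partial_deriv 1 F (\<gamma>' t)) \<tau> = - k * \<gamma>' \<tau> $ 2"
    using assms(2,3,6-11) unfolding \<gamma>'_def
    by (rule normal_curvature_data_imp_derivative)
  then show ?thesis
    by (auto simp: normal_curvature_def DERIV_imp_deriv real_differentiable_def)
qed

end
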